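(* Let $a,b\in\mathbb{C}$ and let $R=\mathrm{CLW}(a,b)$ be the loop $W(a,b)$ Lie conformal algebra, i.e. the free $\mathbb{C}[\partial]$-module $\left(\bigoplus_{i\in\mathbb{Z}}\mathbb{C}[\partial]L_i\right)\oplus\left(\bigoplus_{i\in\mathbb{Z}}\mathbb{C}[\partial]G_i\right)$ with $\lambda$-brackets $$[{L_i}_\lambda L_j]=(\partial+2\lambda)L_{i+j},\quad [{L_i}_\lambda G_j]=(\partial+(1-b)\lambda)G_{i+j},$$ $$[{G_i}_\lambda L_j]=-(b\partial+(b-1)\lambda)G_{i+j},\quad [{G_i}_\lambda G_j]=0$$ for all $i,j\in\mathbb{Z}$. Let $\phi_\lambda:R\times R\to R[\lambda]$ be a skew-symmetric conformal bilinear map. Then $\phi_\lambda$ is a conformal biderivation of $R$ if and only if there exist two families of complex numbers $\{a_k\}_{k\in\mathbb{Z}}$ and $\{b_k\}_{k\in\mathbb{Z}}$ such that, for all $i,j\in\mathbb{Z}$, $$\phi_\lambda(L_i,L_j)=(\partial+2\lambda)\Big(\sum_{k\in\mathbb{Z}}a_{k-i-j}L_k+\delta_{b+1,0}\sum_{k\in\mathbb{Z}}b_{k-i-j}G_k\Big),$$ $$\phi_\lambda(G_i,G_j)=0,\qquad \phi_\lambda(L_i,G_j)=(\partial+(1-b)\lambda)\sum_{k\in\mathbb{Z}}a_{k-i-j}G_k .$$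
   Context: All vector spaces, linear maps and tensor products are over $\mathbb{C}$. A Lie conformal algebra is a $\mathbb{C}[\partial]$-module $R$ with a $\mathbb{C}$-bilinear map $R\times R\to R[\lambda]$, $(x,y)\mapsto[x_\lambda y]$ (the $\lambda$-bracket), such that for all $x,y,z\in R$: (1) $[(\partial x)_\lambda y]=-\lambda[x_\lambda y]$; (2) $[x_\lambda y]=-[y_{-\partial-\lambda}x]$; (3) $[x_\lambda[y_\mu z]]=[[x_\lambda y]_{\lambda+\mu}z]+[y_\mu[x_\lambda z]]$. A conformal bilinear map $\phi_\lambda:R\times R\to R[\lambda]$ is a $\mathbb{C}$-bilinear map with $\phi_\lambda(\partial x,y)=-\lambda\phi_\lambda(x,y)$ and $\phi_\lambda(x,\partial y)=(\partial+\lambda)\phi_\lambda(x,y)$. It is skew-symmetric if $\phi_\lambda(x,y)=-\phi_{-\partial-\lambda}(y,x)$ for all $x,y\in R$. A conformal biderivation of $R$ is a skew-symmetric conformal bilinear map $\phi_\lambda:R\times R\to R[\lambda]$ such that $\phi_\lambda(x,[y_\mu z])=[(\phi_\lambda(x,y))_{\lambda+\mu}z]+[y_\mu\phi_\lambda(x,z)]$ for all $x,y,z\in R$. Conventions: if $\phi_\lambda(y,x)=\sum_n\lambda^n c_n$ with $c_n\in R$, then $\phi_{-\partial-\lambda}(y,x)=\sum_n(-\partial-\lambda)^n c_n$ (and likewise for the bracket); brackets and $\phi$ are extended linearly over polynomials in the formal variables, e.g. $[(\phi_\lambda(x,y))_{\lambda+\mu}z]=\sum_n\lambda^n[{c_n}_{\lambda+\mu}z]$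 if $\phi_\lambda(x,y)=\sum_n\lambda^n c_n$. $\delta_{b+1,0}$ is the Kronecker delta: it equals $1$ if $b=-1$ and $0$ otherwise. The parameter $a$ does not occur in the $\lambda$-brackets. Since $\phi_\lambda$ takes values in $R[\lambda]$ and $R$ is an algebraic direct sum, the sums over $k\in\mathbb{Z}$ are finite sums (only finitely many nonzero terms). *)

theory Defs
  imports Complex_Main "HOL-Library.Poly_Mapping" "HOL-Computational_Algebra.Polynomial"
begin

section \<open>Polynomials with coefficients in a module\<close>

text \<open>
  If \<open>M\<close> is an \<open>A\<close>-module with scalar multiplication \<open>s\<close>, then \<open>M[t]\<close> is the type
  \<open>'m poly\<close>, and \<open>poly_act s\<close> is its \<open>A[t]\<close>-module structure. For a \<open>\<complex>[\<partial>]\<close>-module \<open>R\<close> with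
  scalar multiplication \<open>s\<close>, this gives the action of \<open>\<complex>[\<partial>,\<lambda>]\<close> on \<open>R[\<lambda>]\<close> (\<open>poly_act s\<close>) and,
  iterated, the action of \<open>\<complex>[\<partial>,\<lambda>,\<mu>]\<close> on \<open>R[\<lambda>,\<mu>]\<close> (\<open>poly_act (poly_act s)\<close>). The outermost
  polynomial variable is the last one listed; thus in \<open>complex poly poly\<close> the element \<open>\<partial>\<close> is
  \<open>[:[:0, 1:]:]\<close> and \<open>\<lambda>\<close> is \<open>[:0, 1:]\<close>.
\<close>

definition poly_act ::
  "('a::comm_ring_1 \<Rightarrow> 'm::ab_group_add \<Rightarrow> 'm) \<Rightarrow> 'a poly \<Rightarrow> 'm poly \<Rightarrow> 'm poly" where
  "poly_act s P p = (\<Sum>i\<le>degree P. \<Sum>j\<le>degree p. monom (s (coeff P i) (coeff p j)) (i + j))"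

text \<open>
  For \<open>p = \<Sum>\<^sub>n t\<^sup>n c\<^sub>n\<close>, the value \<open>poly_subst s f V p\<close> is \<open>\<Sum>\<^sub>n V\<^sup>n f(c\<^sub>n)\<close>, where \<open>V\<close> is a scalar
  acting through \<open>s\<close>. It is used both for substituting \<open>V\<close> for the variable and for extending
  a map \<open>f\<close> linearly over polynomials in a formal variable.
\<close>

definition poly_subst ::
  "('a::comm_ring_1 \<Rightarrow> 'm::ab_group_add \<Rightarrow> 'm) \<Rightarrow> ('r::ab_group_add \<Rightarrow> 'm) \<Rightarrow> 'a \<Rightarrow> 'r poly \<Rightarrow> 'm" where
  "poly_subst s f V p = (\<Sum>n\<le>degree p. s (V ^ n) (f (coeff p n)))"

text \<open>The substitution \<open>\<lambda> := -\<partial> - \<lambda>\<close> in \<open>R[\<lambda>]\<close>.\<close>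

definition conf_flip :: "(complex poly \<Rightarrow> 'r::ab_group_add \<Rightarrow> 'r) \<Rightarrow> 'r poly \<Rightarrow> 'r poly" where
  "conf_flip s p = poly_subst (poly_act s) (\<lambda>c. [:c:]) [:[:0, -1:], -1:] p"

text \<open>The variables of \<open>R[\<lambda>,\<mu>]\<close>.\<close>

definition lam :: "complex poly poly poly" where "lam = [:[:0, 1:]:]"
definition mu :: "complex poly poly poly" where "mu = [:0, 1:]"

text \<open>
  \<open>br_at s \<beta> V x y\<close> is \<open>\<beta>\<^sub>V(x,y)\<close> in \<open>R[\<lambda>,\<mu>]\<close>. The other two extend it linearly in the
  second, resp. first argument: \<open>br_at_right s \<beta> V x W q = [x\<^sub>V q\<^sub>W]\<close> and
  \<open>br_at_left s \<beta> V W p z = [(p\<^sub>W)\<^sub>V z]\<close>.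
\<close>

definition br_at :: "(complex poly \<Rightarrow> 'r::ab_group_add \<Rightarrow> 'r) \<Rightarrow> ('r \<Rightarrow> 'r \<Rightarrow> 'r poly)
    \<Rightarrow> complex poly poly poly \<Rightarrow> 'r \<Rightarrow> 'r \<Rightarrow> 'r poly poly" where
  "br_at s \<beta> V x y = poly_subst (poly_act (poly_act s)) (\<lambda>c. [:[:c:]:]) V (\<beta> x y)"

definition br_at_right :: "(complex poly \<Rightarrow> 'r::ab_group_add \<Rightarrow> 'r) \<Rightarrow> ('r \<Rightarrow> 'r \<Rightarrow> 'r poly)
    \<Rightarrow> complex poly poly poly \<Rightarrow> 'r \<Rightarrow> complex poly poly poly \<Rightarrow> 'r poly \<Rightarrow> 'r poly poly" where
  "br_at_right s \<beta> V x W q = poly_subst (poly_act (poly_act s)) (\<lambda>c. br_at s \<beta> V x c) W q"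

definition br_at_left :: "(complex poly \<Rightarrow> 'r::ab_group_add \<Rightarrow> 'r) \<Rightarrow> ('r \<Rightarrow> 'r \<Rightarrow> 'r poly)
    \<Rightarrow> complex poly poly poly \<Rightarrow> complex poly poly poly \<Rightarrow> 'r poly \<Rightarrow> 'r \<Rightarrow> 'r poly poly" where
  "br_at_left s \<beta> V W p z = poly_subst (poly_act (poly_act s)) (\<lambda>c. br_at s \<beta> V c z) W p"


section \<open>Lie conformal algebras and conformal biderivations\<close>

definition C_bilinear :: "(complex poly \<Rightarrow> 'r::ab_group_add \<Rightarrow> 'r) \<Rightarrow> ('r \<Rightarrow> 'r \<Rightarrow> 'r poly) \<Rightarrow> bool" where
  "C_bilinear s \<beta> \<longleftrightarrow>
     (\<forall>y. module_hom (\<lambda>c. s [:c:]) (\<lambda>c. poly_act s [:[:c:]:]) (\<lambda>x. \<beta> x y)) \<and>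
     (\<forall>x. module_hom (\<lambda>c. s [:c:]) (\<lambda>c. poly_act s [:[:c:]:]) (\<lambda>y. \<beta> x y))"

definition conf_skew :: "(complex poly \<Rightarrow> 'r::ab_group_add \<Rightarrow> 'r) \<Rightarrow> ('r \<Rightarrow> 'r \<Rightarrow> 'r poly) \<Rightarrow> bool" where
  "conf_skew s \<beta> \<longleftrightarrow> (\<forall>x y. \<beta> x y = - conf_flip s (\<beta> y x))"

locale lie_conformal_algebra = module s
  for s :: "complex poly \<Rightarrow> 'r::ab_group_add \<Rightarrow> 'r" +
  fixes br :: "'r \<Rightarrow> 'r \<Rightarrow> 'r poly"
  assumes br_bilinear: "C_bilinear s br"
    and br_sesqui: "br (s [:0, 1:] x) y = poly_act s [:0, -1:] (br x y)"
    and br_skew: "conf_skew s br"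
    and br_jacobi: "br_at_right s br lam x mu (br y z) =
      br_at_left s br (lam + mu) lam (br x y) z + br_at_right s br mu y lam (br x z)"

definition conformal_bilinear ::
  "(complex poly \<Rightarrow> 'r::ab_group_add \<Rightarrow> 'r) \<Rightarrow> ('r \<Rightarrow> 'r \<Rightarrow> 'r poly) \<Rightarrow> bool" where
  "conformal_bilinear s \<phi> \<longleftrightarrow> C_bilinear s \<phi> \<and>
     (\<forall>x y. \<phi> (s [:0, 1:] x) y = poly_act s [:0, -1:] (\<phi> x y)) \<and>
     (\<forall>x y. \<phi> x (s [:0, 1:] y) = poly_act s [:[:0, 1:], 1:] (\<phi> x y))"

text \<open>
  The defining identity is
  \<open>\<phi>\<^sub>\<lambda>(x, [y\<^sub>\<mu> z]) = [(\<phi>\<^sub>\<lambda>(x,y))\<^bsub>\<lambda>+\<mu>\<^esub> z] + [y\<^sub>\<mu> \<phi>\<^sub>\<lambda>(x,z)]\<close> in \<open>R[\<lambda>,\<mu>]\<close>.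
\<close>

definition conformal_biderivation :: "(complex poly \<Rightarrow> 'r::ab_group_add \<Rightarrow> 'r)
    \<Rightarrow> ('r \<Rightarrow> 'r \<Rightarrow> 'r poly) \<Rightarrow> ('r \<Rightarrow> 'r \<Rightarrow> 'r poly) \<Rightarrow> bool" where
  "conformal_biderivation s br \<phi> \<longleftrightarrow> conformal_bilinear s \<phi> \<and> conf_skew s \<phi> \<and>
     (\<forall>x y z. br_at_right s \<phi> lam x mu (br y z) =
        br_at_left s br (lam + mu) lam (\<phi> x y) z + br_at_right s br mu y lam (\<phi> x z))"


section \<open>The loop \<open>W(a,b)\<close> Lie conformal algebra\<close>

datatype clw_gen = LGen int | GGen int

type_synonym clw = "clw_gen \<Rightarrow>\<^sub>0 complex poly"

definition clw_scale :: "complex poly \<Rightarrow> clw \<Rightarrow> clw" where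
  "clw_scale p x = Poly_Mapping.map (\<lambda>q. p * q) x"

definition clw_L :: "int \<Rightarrow> clw" where "clw_L i = Poly_Mapping.single (LGen i) 1"
definition clw_G :: "int \<Rightarrow> clw" where "clw_G i = Poly_Mapping.single (GGen i) 1"

fun clw_gen_br :: "complex \<Rightarrow> complex \<Rightarrow> clw_gen \<Rightarrow> clw_gen \<Rightarrow> clw poly" where
  "clw_gen_br a b (LGen i) (LGen j) = poly_act clw_scale [:[:0, 1:], [:2:]:] [:clw_L (i + j):]"
| "clw_gen_br a b (LGen i) (GGen j) = poly_act clw_scale [:[:0, 1:], [:1 - b:]:] [:clw_G (i + j):]"
| "clw_gen_br a b (GGen i) (LGen j) = - poly_act clw_scale [:[:0, b:], [:b - 1:]:] [:clw_G (i + j):]"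
| "clw_gen_br a b (GGen i) (GGen j) = 0"

text \<open>For \<open>p\<close> in \<open>\<complex>[\<partial>]\<close>, the polynomial \<open>p(Q)\<close> in \<open>\<complex>[\<partial>,\<lambda>]\<close>.\<close>

definition poly_del :: "complex poly \<Rightarrow> complex poly poly \<Rightarrow> complex poly poly" where
  "poly_del p Q = poly (map_poly (\<lambda>c. [:[:c:]:]) p) Q"

text \<open>
  The extension of the bracket from the generators to the free module is forced by
  sesquilinearity: \<open>[(p(\<partial>) g)\<^sub>\<lambda> (q(\<partial>) h)] = p(-\<lambda>) q(\<partial>+\<lambda>) [g\<^sub>\<lambda> h]\<close>.
\<close>

definition clw_br :: "complex \<Rightarrow> complex \<Rightarrow> clw \<Rightarrow> clw \<Rightarrow> clw poly" where
  "clw_br a b x y =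
     (\<Sum>g\<in>Poly_Mapping.keys x. \<Sum>h\<in>Poly_Mapping.keys y.
        poly_act clw_scale
          (poly_del (Poly_Mapping.lookup x g) [:0, -1:] *
           poly_del (Poly_Mapping.lookup y h) [:[:0, 1:], 1:])
          (clw_gen_br a b g h))"


section \<open>Calculus of \<open>poly_act\<close> and \<open>poly_subst\<close>\<close>

lemma coeff_poly_act:
  assumes "module s"
  shows "coeff (poly_act s P p) n = (\<Sum>i\<le>n. s (coeff P i) (coeff p (n - i)))"
proof -
  interpret module s by fact
  have "coeff (poly_act s P p) n =
      (\<Sum>i\<le>degree P. \<Sum>j\<le>degree p. if i + j = n then s (coeff P i) (coeff p j) else 0)"
    by (simp add: poly_act_def coeff_sum coeff_monom)
  also have "\<dots> = (\<Sum>i\<le>degree P. if i \<le> n then s (coeff P i) (coeff p (n - i)) else 0)"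
  proof (rule sum.cong[OF refl])
    fix i
    have "(\<Sum>j\<le>degree p. if i + j = n then s (coeff P i) (coeff p j) else 0) =
       (\<Sum>j\<le>degree p. if j = n - i then (if i \<le> n then s (coeff P i) (coeff p j) else 0) else 0)"
      by (rule sum.cong) auto
    also have "\<dots> = (if i \<le> n then s (coeff P i) (coeff p (n - i)) else 0)"
      by (auto simp: sum.delta coeff_eq_0)
    finally show "(\<Sum>j\<le>degree p. if i + j = n then s (coeff P i) (coeff p j) else 0) =
       (if i \<le> n then s (coeff P i) (coeff p (n - i)) else 0)" .
  qed
  also have "\<dots> = (\<Sum>i\<in>{..degree P} \<inter> {..n}. s (coeff P i) (coeff p (n - i)))"
    by (subst sum.inter_restrict) auto
  also have "\<dots> = (\<Sum>i\<le>n. s (coeff P i) (coeff p (n - i)))"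
    by (rule sum.mono_neutral_left) (auto, metis le_degree scale_zero_left)
  finally show ?thesis .
qed

lemma poly_act_pCons_left:
  assumes "module s"
  shows "poly_act s (pCons c P) p = map_poly (s c) p + pCons 0 (poly_act s P p)"
proof -
  interpret module s by fact
  show ?thesis
  proof (rule poly_eqI)
    fix n
    show "coeff (poly_act s (pCons c P) p) n =
        coeff (map_poly (s c) p + pCons 0 (poly_act s P p)) n"
      by (cases n)
        (simp_all add: coeff_poly_act[OF assms] coeff_map_poly sum.atMost_Suc_shift
           del: sum.atMost_Suc)
  qed
qed

lemma module_poly_act:
  assumes "module s"
  shows "module (poly_act s)"
proof -
  interpret module s by fact
  note ca = coeff_poly_act[OF assms]
  have 0: "poly_act s 0 p = 0" for p by (rule poly_eqI) (simp add: ca)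
  have sm: "poly_act s (smult c P) p = map_poly (s c) (poly_act s P p)" for c P p
    by (rule poly_eqI) (simp add: ca coeff_map_poly scale_sum_right)
  have ld: "poly_act s (P + Q) p = poly_act s P p + poly_act s Q p" for P Q p
    by (rule poly_eqI) (simp add: ca scale_left_distrib sum.distrib)
  show ?thesis
  proof
    show "poly_act s P (p + q) = poly_act s P p + poly_act s P q" for P p q
      by (rule poly_eqI) (simp add: ca scale_right_distrib sum.distrib)
    show "poly_act s (P + Q) p = poly_act s P p + poly_act s Q p" for P Q p by (rule ld)
    show "poly_act s 1 p = p" for p
      by (rule poly_eqI) (simp add: one_pCons poly_act_pCons_left[OF assms] 0 coeff_map_poly)
    show "poly_act s P (poly_act s Q p) = poly_act s (P * Q) p" for P Q p
    proof (induction P)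
      case (pCons c P)
      have z: "poly_act s (pCons 0 R) p = pCons 0 (poly_act s R p)" for R
        by (rule poly_eqI) (simp add: poly_act_pCons_left[OF assms] coeff_map_poly)
      show ?case
        by (simp add: poly_act_pCons_left[OF assms, of c P] pCons.IH ld sm z)
    qed (simp add: 0)
  qed
qed

lemma poly_act_pCons_right:
  assumes "module s"
  shows "poly_act s P (pCons c p) = poly_act s P [:c:] + pCons 0 (poly_act s P p)"
proof -
  interpret module s by fact
  show ?thesis
  proof (rule poly_eqI)
    fix n
    show "coeff (poly_act s P (pCons c p)) n =
        coeff (poly_act s P [:c:] + pCons 0 (poly_act s P p)) n"
    proof (cases n)
      case (Suc m)
      have "(\<Sum>i\<le>m. s (coeff P i) (coeff [:c:] (Suc m - i))) = 0"
        by (rule sum.neutral) (auto simp: Suc_diff_le)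
      moreover have "(\<Sum>i\<le>m. s (coeff P i) (coeff (pCons c p) (Suc m - i))) =
          (\<Sum>i\<le>m. s (coeff P i) (coeff p (m - i)))"
        by (rule sum.cong) (auto simp: Suc_diff_le)
      ultimately show ?thesis
        by (simp add: Suc coeff_poly_act[OF assms])
    qed (simp add: coeff_poly_act[OF assms])
  qed
qed

lemma poly_subst_pCons:
  assumes "module s" "f 0 = 0"
  shows "poly_subst s f V (pCons c p) = f c + s V (poly_subst s f V p)"
proof -
  interpret module s by fact
  show ?thesis
    using assms(2)
    by (cases "p = 0")
      (simp_all add: poly_subst_def sum.atMost_Suc_shift scale_sum_right del: sum.atMost_Suc)
qed

lemma poly_subst_0: "module s \<Longrightarrow> f 0 = 0 \<Longrightarrow> poly_subst s f V 0 = 0"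
  by (simp add: poly_subst_def module.scale_zero_right)

lemma poly_subst_add:
  assumes "module s" "additive f"
  shows "poly_subst s f V (p + q) = poly_subst s f V p + poly_subst s f V q"
proof -
  interpret module s by fact
  interpret additive f by fact
  show ?thesis
    by (induction p q rule: poly_induct2)
      (simp_all add: poly_subst_pCons[OF assms(1)] poly_subst_0[OF assms(1)] zero add
        scale_right_distrib algebra_simps)
qed

text \<open>A substitution carries the action of \<open>A[t]\<close> to the substituted scalars.\<close>

lemma poly_subst_act:
  fixes h :: "'a::comm_ring_1 \<Rightarrow> 'b::comm_ring_1"
  assumes "module s" "module t" "additive f" and h: "h 0 = 0"
    and f: "\<And>c x. f (s c x) = t (h c) (f x)"
  shows "poly_subst t f V (poly_act s P p) = t (poly (map_poly h P) V) (poly_subst t f V p)"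
proof -
  interpret s: module s by fact
  interpret t: module t by fact
  interpret ps: module "poly_act s" by (rule module_poly_act) fact
  interpret additive f by fact
  note pc = poly_subst_pCons[where f = f, OF \<open>module t\<close> zero]
  note p0 = poly_subst_0[where f = f, OF \<open>module t\<close> zero]
  have m: "poly_subst t f V (map_poly (s c) p) = t (h c) (poly_subst t f V p)" for c
    by (induction p) (simp_all add: map_poly_pCons pc p0 f t.scale_right_distrib mult.commute)
  show ?thesis
  proof (induction P)
    case (pCons c P)
    show ?case
      by (simp add: poly_act_pCons_left[OF \<open>module s\<close>]
          poly_subst_add[OF \<open>module t\<close> \<open>additive f\<close>] m pc zero pCons.IH map_poly_pCons h
          t.scale_left_distrib)
  qed (simp add: p0)
qed


section \<open>Calculus of conformal bilinear maps\<close>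

lemma C_bilinear_add_left: "C_bilinear s \<beta> \<Longrightarrow> \<beta> (x + y) z = \<beta> x z + \<beta> y z"
  unfolding C_bilinear_def using module_hom.add by blast

lemma C_bilinear_add_right: "C_bilinear s \<beta> \<Longrightarrow> \<beta> x (y + z) = \<beta> x y + \<beta> x z"
  unfolding C_bilinear_def using module_hom.add by blast

lemma C_bilinear_scale_left: "C_bilinear s \<beta> \<Longrightarrow> \<beta> (s [:c:] x) y = poly_act s [:[:c:]:] (\<beta> x y)"
  unfolding C_bilinear_def using module_hom.scale[of "\<lambda>c. s [:c:]"] by blast

lemma C_bilinear_scale_right: "C_bilinear s \<beta> \<Longrightarrow> \<beta> x (s [:c:] y) = poly_act s [:[:c:]:] (\<beta> x y)"
  unfolding C_bilinear_def using module_hom.scale[of "\<lambda>c. s [:c:]"] by blast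

lemma module_const:
  fixes s :: "complex poly \<Rightarrow> 'r::ab_group_add \<Rightarrow> 'r"
  assumes "module s"
  shows "module (\<lambda>c. s [:c:])" "module (\<lambda>c. poly_act s [:[:c:]:])"
proof -
  have *: "module (\<lambda>c. t (f c))"
    if "module t" "f 1 = 1" "\<And>a b. f (a + b) = f a + f b" "\<And>a b. f (a * b) = f a * f b"
    for t :: "'c::comm_ring_1 \<Rightarrow> 'd::ab_group_add \<Rightarrow> 'd" and f :: "complex \<Rightarrow> 'c"
  proof -
    interpret module t by fact
    show ?thesis
      by standard (simp_all add: that(2-4) scale_left_distrib scale_right_distrib)
  qed
  show "module (\<lambda>c. s [:c:])"
    by (rule *[OF assms]) (simp_all add: one_pCons)
  show "module (\<lambda>c. poly_act s [:[:c:]:])"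
    by (rule *[OF module_poly_act[OF assms]]) (simp_all add: one_pCons)
qed

lemma C_bilinearI:
  assumes "module s"
    and "\<And>x y z. \<beta> (x + y) z = \<beta> x z + \<beta> y z"
    and "\<And>x y z. \<beta> x (y + z) = \<beta> x y + \<beta> x z"
    and "\<And>c x y. \<beta> (s [:c:] x) y = poly_act s [:[:c:]:] (\<beta> x y)"
    and "\<And>c x y. \<beta> x (s [:c:] y) = poly_act s [:[:c:]:] (\<beta> x y)"
  shows "C_bilinear s \<beta>"
  unfolding C_bilinear_def module_hom_def module_hom_axioms_def
  using assms module_const[OF assms(1)] by auto

lemma smult_consts:
  fixes p :: "'a::comm_ring_1 poly poly" and q :: "'a poly poly poly"
  shows "smult [:1:] p = p" "smult [:-1:] p = - p"
    "smult [:[:1:]:] q = q" "smult [:[:-1:]:] q = - q"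
  by (rule poly_eqI, simp)+

text \<open>For \<open>p\<close> in \<open>\<complex>[\<partial>]\<close>, the polynomial \<open>p(Q)\<close> in \<open>\<complex>[\<partial>,\<lambda>,\<mu>]\<close>.\<close>

definition poly_del2 :: "complex poly \<Rightarrow> complex poly poly poly \<Rightarrow> complex poly poly poly" where
  "poly_del2 p Q = poly (map_poly (\<lambda>c. [:[:[:c:]:]:]) p) Q"

lemma poly_del2_pCons [simp]: "poly_del2 (pCons c p) Q = [:[:[:c:]:]:] + Q * poly_del2 p Q"
  by (simp add: poly_del2_def map_poly_pCons)

lemma poly_del2_1 [simp]: "poly_del2 1 Q = 1"
  by (simp add: poly_del2_def map_poly_1 pCons_one)

lemma poly_del2_m1 [simp]: "poly_del2 (-1) Q = -1"
  by (simp add: poly_del2_def map_poly_pCons one_pCons)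

lemma poly_del2_0 [simp]: "poly_del2 0 Q = 0"
  by (simp add: poly_del2_def)

locale conf_bilinear = module s
  for s :: "complex poly \<Rightarrow> 'r::ab_group_add \<Rightarrow> 'r" +
  fixes \<beta> :: "'r \<Rightarrow> 'r \<Rightarrow> 'r poly"
  assumes conf_bilinear: "conformal_bilinear s \<beta>"
begin

sublocale A1: module "poly_act s" by (rule module_poly_act) (rule module_axioms)
sublocale A2: module "poly_act (poly_act s)" by (rule module_poly_act) (rule A1.module_axioms)

lemma
  shows add_left: "\<beta> (x + y) z = \<beta> x z + \<beta> y z"
    and add_right: "\<beta> x (y + z) = \<beta> x y + \<beta> x z"
    and const_left: "\<beta> (s [:c:] x) y = poly_act s [:[:c:]:] (\<beta> x y)"
    and const_right: "\<beta> x (s [:c:] y) = poly_act s [:[:c:]:] (\<beta> x y)"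
    and del_left: "\<beta> (s [:0, 1:] x) y = poly_act s [:0, -1:] (\<beta> x y)"
    and del_right: "\<beta> x (s [:0, 1:] y) = poly_act s [:[:0, 1:], 1:] (\<beta> x y)"
  using conf_bilinear unfolding conformal_bilinear_def
  by (auto simp: C_bilinear_add_left C_bilinear_add_right C_bilinear_scale_left C_bilinear_scale_right)

lemma poly_act2_const: "poly_act (poly_act s) [:[:p:]:] [:[:c:]:] = [:[:s p c:]:]"
  by (simp add: poly_act_pCons_left[OF A1.module_axioms] poly_act_pCons_left[OF module_axioms]
      map_poly_pCons)

lemma subst2_act:
  "poly_subst (poly_act (poly_act s)) (\<lambda>c. [:[:c:]:]) V (poly_act s P q) =
   poly_act (poly_act s) (poly (map_poly (\<lambda>p. [:[:p:]:]) P) V)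
     (poly_subst (poly_act (poly_act s)) (\<lambda>c. [:[:c:]:]) V q)"
  by (rule poly_subst_act[OF module_axioms A2.module_axioms])
    (auto simp: poly_act2_const additive_def)

lemma subst2_add:
  "poly_subst (poly_act (poly_act s)) (\<lambda>c. [:[:c:]:]) V (p + q) =
   poly_subst (poly_act (poly_act s)) (\<lambda>c. [:[:c:]:]) V p +
   poly_subst (poly_act (poly_act s)) (\<lambda>c. [:[:c:]:]) V q"
  by (rule poly_subst_add[OF A2.module_axioms]) (simp add: additive_def)

lemma
  shows br_at_add_left: "br_at s \<beta> V (x + y) z = br_at s \<beta> V x z + br_at s \<beta> V y z"
    and br_at_add_right: "br_at s \<beta> V x (y + z) = br_at s \<beta> V x y + br_at s \<beta> V x z"
    and br_at_const_left:
      "br_at s \<beta> V (s [:c:] x) y = poly_act (poly_act s) [:[:[:c:]:]:] (br_at s \<beta> V x y)"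
    and br_at_const_right:
      "br_at s \<beta> V x (s [:c:] y) = poly_act (poly_act s) [:[:[:c:]:]:] (br_at s \<beta> V x y)"
    and br_at_del_left:
      "br_at s \<beta> V (s [:0, 1:] x) y = poly_act (poly_act s) (- V) (br_at s \<beta> V x y)"
    and br_at_del_right:
      "br_at s \<beta> V x (s [:0, 1:] y) =
       poly_act (poly_act s) ([:[:[:0, 1:]:]:] + V) (br_at s \<beta> V x y)"
  by (simp_all add: br_at_def add_left add_right const_left const_right del_left del_right
      subst2_act subst2_add map_poly_pCons
          map_poly_1 smult_consts)

lemma additive_br_at: "additive (br_at s \<beta> V x)" "additive (\<lambda>x. br_at s \<beta> V x y)"
  by (simp_all add: additive_def br_at_add_left br_at_add_right)

lemma br_at_scale_left:
  "br_at s \<beta> V (s p x) y = poly_act (poly_act s) (poly_del2 p (- V)) (br_at s \<beta> V x y)"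
proof (induction p)
  case (pCons c p)
  have "s (pCons c p) x = s [:c:] x + s [:0, 1:] (s p x)"
    by (simp flip: scale_left_distrib)
  then show ?case
    by (simp add: br_at_add_left br_at_const_left br_at_del_left pCons.IH A2.scale_left_distrib
        A2.scale_left_diff_distrib del: scale_scale)
qed (use additive.zero[OF additive_br_at(2)] in simp)

lemma br_at_scale_right:
  "br_at s \<beta> V x (s p y) =
   poly_act (poly_act s) (poly_del2 p ([:[:[:0, 1:]:]:] + V)) (br_at s \<beta> V x y)"
proof (induction p)
  case (pCons c p)
  have "s (pCons c p) y = s [:c:] y + s [:0, 1:] (s p y)"
    by (simp flip: scale_left_distrib)
  then show ?case
    by (simp add: br_at_add_right br_at_const_right br_at_del_right pCons.IH A2.scale_left_distrib
        A2.scale_left_diff_distrib del: scale_scale)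
qed (use additive.zero[OF additive_br_at(1)] in simp)

lemma br_at_right_act:
  "br_at_right s \<beta> V x W (poly_act s P q) =
   poly_act (poly_act s) (poly (map_poly (\<lambda>p. poly_del2 p ([:[:[:0, 1:]:]:] + V)) P) W)
     (br_at_right s \<beta> V x W q)"
  unfolding br_at_right_def
  by (rule poly_subst_act[OF module_axioms A2.module_axioms additive_br_at(1)])
    (simp_all add: br_at_scale_right)

lemma br_at_left_act:
  "br_at_left s \<beta> V W (poly_act s P q) z =
   poly_act (poly_act s) (poly (map_poly (\<lambda>p. poly_del2 p (- V)) P) W) (br_at_left s \<beta> V W q z)"
  unfolding br_at_left_def
  by (rule poly_subst_act[OF module_axioms A2.module_axioms additive_br_at(2)])
    (simp_all add: br_at_scale_left)

lemma
  shows br_at_right_add: "br_at_right s \<beta> V x W (p + q) =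
      br_at_right s \<beta> V x W p + br_at_right s \<beta> V x W q"
    and br_at_left_add: "br_at_left s \<beta> V W (p + q) z =
      br_at_left s \<beta> V W p z + br_at_left s \<beta> V W q z"
  unfolding br_at_right_def br_at_left_def
  by (rule poly_subst_add[OF A2.module_axioms], rule additive_br_at)+

lemma
  shows br_at_right_add_arg: "br_at_right s \<beta> V (x + y) W q =
      br_at_right s \<beta> V x W q + br_at_right s \<beta> V y W q"
    and br_at_left_add_arg: "br_at_left s \<beta> V W p (y + z) =
      br_at_left s \<beta> V W p y + br_at_left s \<beta> V W p z"
    and br_at_right_scale_arg: "br_at_right s \<beta> V (s r x) W q =
      poly_act (poly_act s) (poly_del2 r (- V)) (br_at_right s \<beta> V x W q)"
    and br_at_left_scale_arg: "br_at_left s \<beta> V W p (s r z) =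
      poly_act (poly_act s) (poly_del2 r ([:[:[:0, 1:]:]:] + V)) (br_at_left s \<beta> V W p z)"
  unfolding br_at_right_def br_at_left_def
  by (simp_all add: poly_subst_def br_at_add_left br_at_add_right br_at_scale_left
      br_at_scale_right A2.scale_right_distrib sum.distrib A2.scale_sum_right mult.commute)

lemma
  shows br_at_right_const: "br_at_right s \<beta> V x W [:y:] = br_at s \<beta> V x y"
    and br_at_left_const: "br_at_left s \<beta> V W [:y:] z = br_at s \<beta> V y z"
  unfolding br_at_right_def br_at_left_def by (simp_all add: poly_subst_def)

lemma flip_act:
  "conf_flip s (poly_act s P q) =
   poly_act s (poly (map_poly (\<lambda>p. [:p:]) P) [:[:0, -1:], -1:]) (conf_flip s q)"
  unfolding conf_flip_def
  by (rule poly_subst_act[OF module_axioms A1.module_axioms])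
    (auto simp: additive_def poly_act_pCons_left[OF module_axioms] map_poly_pCons)

lemma flip_add: "conf_flip s (p + q) = conf_flip s p + conf_flip s q"
  unfolding conf_flip_def
  by (rule poly_subst_add[OF A1.module_axioms]) (simp add: additive_def)

end

text \<open>The identity of a biderivation (for \<open>\<phi> = br\<close>, the Jacobi identity) at one triple.\<close>

definition leibniz_at :: "(complex poly \<Rightarrow> 'r::ab_group_add \<Rightarrow> 'r) \<Rightarrow> ('r \<Rightarrow> 'r \<Rightarrow> 'r poly)
    \<Rightarrow> ('r \<Rightarrow> 'r \<Rightarrow> 'r poly) \<Rightarrow> 'r \<Rightarrow> 'r \<Rightarrow> 'r \<Rightarrow> bool" where
  "leibniz_at s br \<phi> x y z \<longleftrightarrow> br_at_right s \<phi> lam x mu (br y z) =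
     br_at_left s br (lam + mu) lam (\<phi> x y) z + br_at_right s br mu y lam (\<phi> x z)"

context
  fixes s :: "complex poly \<Rightarrow> 'r::ab_group_add \<Rightarrow> 'r" and br \<phi>
  assumes "conf_bilinear s br" "conf_bilinear s \<phi>"
begin

interpretation B: conf_bilinear s br by fact
interpretation F: conf_bilinear s \<phi> by fact

lemma
  assumes "leibniz_at s br \<phi> x y z"
  shows leibniz_at_add1: "leibniz_at s br \<phi> x' y z \<Longrightarrow> leibniz_at s br \<phi> (x + x') y z"
    and leibniz_at_add2: "leibniz_at s br \<phi> x y' z \<Longrightarrow> leibniz_at s br \<phi> x (y + y') z"
    and leibniz_at_add3: "leibniz_at s br \<phi> x y z' \<Longrightarrow> leibniz_at s br \<phi> x y (z + z')"
  using assms unfolding leibniz_at_def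
  by (simp_all add: B.add_left B.add_right F.add_left F.add_right
      B.br_at_right_add B.br_at_left_add F.br_at_right_add
      B.br_at_right_add_arg B.br_at_left_add_arg F.br_at_right_add_arg)

lemma
  assumes "leibniz_at s br \<phi> x y z"
  shows leibniz_at_const1: "leibniz_at s br \<phi> (s [:c:] x) y z"
    and leibniz_at_const2: "leibniz_at s br \<phi> x (s [:c:] y) z"
    and leibniz_at_const3: "leibniz_at s br \<phi> x y (s [:c:] z)"
  using assms unfolding leibniz_at_def
  by (simp_all add: B.const_left B.const_right F.const_left F.const_right map_poly_pCons
      B.br_at_right_act B.br_at_left_act F.br_at_right_act
      B.br_at_right_scale_arg B.br_at_left_scale_arg F.br_at_right_scale_arg
      B.A2.scale_right_distrib)

lemma
  assumes "leibniz_at s br \<phi> x y z"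
  shows leibniz_at_del1: "leibniz_at s br \<phi> (s [:0, 1:] x) y z"
    and leibniz_at_del2: "leibniz_at s br \<phi> x (s [:0, 1:] y) z"
    and leibniz_at_del3: "leibniz_at s br \<phi> x y (s [:0, 1:] z)"
  using assms unfolding leibniz_at_def
  by (simp_all add: B.del_left B.del_right F.del_left F.del_right map_poly_pCons
      B.br_at_right_act B.br_at_left_act F.br_at_right_act
      B.br_at_right_scale_arg B.br_at_left_scale_arg F.br_at_right_scale_arg
      B.A2.scale_right_distrib map_poly_1 smult_consts algebra_simps)
end


section \<open>\<open>CLW(a,b)\<close> is a Lie conformal algebra\<close>

lemma lookup_clw_scale [simp]:
  "Poly_Mapping.lookup (clw_scale p x) g = p * Poly_Mapping.lookup x g"
  by (simp add: clw_scale_def Poly_Mapping.map.rep_eq when_def)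

lemma clw_scale_single: "clw_scale p (Poly_Mapping.single g q) = Poly_Mapping.single g (p * q)"
  by (rule poly_mapping_eqI) (simp add: lookup_single when_def)

lemma module_clw_scale: "module clw_scale"
  by standard (rule poly_mapping_eqI, simp add: lookup_add algebra_simps)+

interpretation clw: module clw_scale by (rule module_clw_scale)
interpretation clw1: module "poly_act clw_scale" by (rule module_poly_act[OF module_clw_scale])
interpretation clw2: module "poly_act (poly_act clw_scale)"
  by (rule module_poly_act[OF clw1.module_axioms])

text \<open>\<open>clw_scale\<close> makes \<open>clw\<close> the free \<open>\<complex>[\<partial>]\<close>-module on the generators.\<close>

lemma clw_expansion:
  "x = (\<Sum>g\<in>Poly_Mapping.keys x.
          clw_scale (Poly_Mapping.lookup x g) (Poly_Mapping.single g 1))"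
  by (rule poly_mapping_eqI)
    (simp add: lookup_sum lookup_single when_def if_distrib in_keys_iff cong: if_cong)

lemma clw_basis_unique:
  assumes "finite A" "(\<Sum>g\<in>A. clw_scale (f g) (Poly_Mapping.single g 1)) = 0" "g \<in> A"
  shows "f g = 0"
proof -
  have "Poly_Mapping.lookup (\<Sum>g\<in>A. clw_scale (f g) (Poly_Mapping.single g 1)) g = f g"
    using assms(1,3) by (simp add: lookup_sum lookup_single when_def if_distrib cong: if_cong)
  then show ?thesis using assms(2) by simp
qed

lemma clw_induct [case_names gen add const del]:
  assumes "\<And>g. P (Poly_Mapping.single g 1)"
    and "\<And>x y. P x \<Longrightarrow> P y \<Longrightarrow> P (x + y)"
    and "\<And>c x. P x \<Longrightarrow> P (clw_scale [:c:] x)"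
    and "\<And>x. P x \<Longrightarrow> P (clw_scale [:0, 1:] x)"
  shows "P x"
proof -
  have 0: "P 0" using assms(3)[of "Poly_Mapping.single g 1" 0 for g] assms(1) by simp
  have s: "P (clw_scale p x)" if "P x" for p x
  proof (induction p)
    case (pCons c p)
    have "clw_scale (pCons c p) x = clw_scale [:c:] x + clw_scale [:0, 1:] (clw_scale p x)"
      by (simp flip: clw.scale_left_distrib)
    then show ?case using that pCons.IH assms(2-4) by metis
  qed (simp add: 0)
  have "P (\<Sum>g\<in>A. clw_scale (f g) (Poly_Mapping.single g 1))" if "finite A" for A f
    using that by induction (auto intro: 0 s assms)
  then show ?thesis using clw_expansion[of x] by (metis finite_keys)
qed

lemma poly_del_pCons [simp]: "poly_del (pCons c p) Q = [:[:c:]:] + Q * poly_del p Q"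
  by (simp add: poly_del_def map_poly_pCons)

lemma poly_del_0 [simp]: "poly_del 0 Q = 0"
  by (simp add: poly_del_def)

lemma poly_del_add: "poly_del (p + q) Q = poly_del p Q + poly_del q Q"
  by (induction p q rule: poly_induct2) (simp_all add: algebra_simps)

lemma poly_del_smult: "poly_del (smult c p) Q = [:[:c:]:] * poly_del p Q"
  by (induction p) (simp_all add: algebra_simps)

lemma poly_del_1 [simp]: "poly_del 1 Q = 1"
  by (simp add: poly_del_def map_poly_1 pCons_one)

lemma clw_br_superset:
  assumes "finite A" "finite B" "Poly_Mapping.keys x \<subseteq> A" "Poly_Mapping.keys y \<subseteq> B"
  shows "clw_br a b x y = (\<Sum>g\<in>A. \<Sum>h\<in>B.
        poly_act clw_scale
          (poly_del (Poly_Mapping.lookup x g) [:0, -1:] *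
           poly_del (Poly_Mapping.lookup y h) [:[:0, 1:], 1:])
          (clw_gen_br a b g h))"
proof -
  let ?t = "\<lambda>g h. poly_act clw_scale
          (poly_del (Poly_Mapping.lookup x g) [:0, -1:] *
           poly_del (Poly_Mapping.lookup y h) [:[:0, 1:], 1:])
          (clw_gen_br a b g h)"
  have "clw_br a b x y = (\<Sum>g\<in>Poly_Mapping.keys x. \<Sum>h\<in>B. ?t g h)"
    unfolding clw_br_def
    by (intro sum.cong[OF refl] sum.mono_neutral_left) (use assms in \<open>auto simp: in_keys_iff\<close>)
  also have "\<dots> = (\<Sum>g\<in>A. \<Sum>h\<in>B. ?t g h)"
    by (intro sum.mono_neutral_left) (use assms in \<open>auto simp: in_keys_iff\<close>)
  finally show ?thesis .
qed

lemma clw_br_add_left: "clw_br a b (x + y) z = clw_br a b x z + clw_br a b y z"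
proof -
  let ?A = "Poly_Mapping.keys x \<union> Poly_Mapping.keys y"
  have k: "Poly_Mapping.keys (x + y) \<subseteq> ?A" by (rule keys_add)
  show ?thesis
    using k by (subst (1 2 3) clw_br_superset[of ?A "Poly_Mapping.keys z"])
      (simp_all add: lookup_add poly_del_add distrib_right clw1.scale_left_distrib sum.distrib)
qed

lemma clw_br_add_right: "clw_br a b x (y + z) = clw_br a b x y + clw_br a b x z"
proof -
  let ?A = "Poly_Mapping.keys y \<union> Poly_Mapping.keys z"
  have k: "Poly_Mapping.keys (y + z) \<subseteq> ?A" by (rule keys_add)
  show ?thesis
    using k by (subst (1 2 3) clw_br_superset[of "Poly_Mapping.keys x" ?A])
      (simp_all add: lookup_add poly_del_add distrib_left clw1.scale_left_distrib sum.distrib)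
qed

lemma keys_clw_scale: "Poly_Mapping.keys (clw_scale p x) \<subseteq> Poly_Mapping.keys x"
  by (auto simp: in_keys_iff)

lemma clw_br_scale_left:
  assumes "\<And>q. poly_del (p * q) [:0, -1:] = P * poly_del q [:0, -1:]"
  shows "clw_br a b (clw_scale p x) y = poly_act clw_scale P (clw_br a b x y)"
  using keys_clw_scale[of p x]
  by (subst (1 2) clw_br_superset[of "Poly_Mapping.keys x" "Poly_Mapping.keys y"])
    (simp_all add: assms clw1.scale_sum_right mult.assoc)

lemma clw_br_scale_right:
  assumes "\<And>q. poly_del (p * q) [:[:0, 1:], 1:] = P * poly_del q [:[:0, 1:], 1:]"
  shows "clw_br a b x (clw_scale p y) = poly_act clw_scale P (clw_br a b x y)"
  using keys_clw_scale[of p y]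
  by (subst (1 2) clw_br_superset[of "Poly_Mapping.keys x" "Poly_Mapping.keys y"])
    (simp_all add: assms clw1.scale_sum_right mult.left_commute)

lemma clw_br_conformal_bilinear: "conformal_bilinear clw_scale (clw_br a b)"
  unfolding conformal_bilinear_def
  by (intro conjI allI C_bilinearI module_clw_scale clw_br_add_left clw_br_add_right
      clw_br_scale_left clw_br_scale_right) (simp_all add: poly_del_smult)

interpretation clw_br: conf_bilinear clw_scale "clw_br a b" for a b
  by unfold_locales (rule clw_br_conformal_bilinear)

lemma clw_br_gen:
  "clw_br a b (Poly_Mapping.single g 1) (Poly_Mapping.single h 1) = clw_gen_br a b g h"
  by (simp add: clw_br_def)

lemma clw_br_generators:
  "clw_br a b (clw_L i) (clw_L j) = poly_act clw_scale [:[:0, 1:], [:2:]:] [:clw_L (i + j):]"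
  "clw_br a b (clw_L i) (clw_G j) = poly_act clw_scale [:[:0, 1:], [:1 - b:]:] [:clw_G (i + j):]"
  "clw_br a b (clw_G i) (clw_L j) = - poly_act clw_scale [:[:0, b:], [:b - 1:]:] [:clw_G (i + j):]"
  "clw_br a b (clw_G i) (clw_G j) = 0"
  by (simp_all add: clw_L_def clw_G_def clw_br_gen)

lemma clw_br_skew: "conf_skew clw_scale (clw_br a b)"
proof -
  have g: "clw_br a b (Poly_Mapping.single g 1) (Poly_Mapping.single h 1) =
      - conf_flip clw_scale (clw_br a b (Poly_Mapping.single h 1) (Poly_Mapping.single g 1))" for g h
  proof -
    have c: "conf_flip clw_scale [:x:] = [:x:]" for x by (simp add: conf_flip_def poly_subst_def)
    show ?thesis
      by (cases g; cases h; unfold clw_br_gen clw_gen_br.simps)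
        (simp_all add: clw_br.flip_act c c[of 0, simplified] map_poly_pCons add.commute
          flip: clw1.scale_minus_left)
  qed
  have g1: "clw_br a b (Poly_Mapping.single g 1) y =
      - conf_flip clw_scale (clw_br a b y (Poly_Mapping.single g 1))" for g y
  proof (induction y rule: clw_induct)
    case (gen h)
    show ?case by (rule g)
  next
    case (del y)
    then show ?case
      by (simp add: clw_br.del_left clw_br.del_right clw_br.flip_act map_poly_pCons
          map_poly_1 smult_consts)
  qed (simp_all add: clw_br.add_left clw_br.add_right clw_br.flip_add clw_br.const_left
        clw_br.const_right clw_br.flip_act map_poly_pCons)
  have "clw_br a b x y = - conf_flip clw_scale (clw_br a b y x)" for x y
  proof (induction x rule: clw_induct)
    case (gen g)
    show ?case by (rule g1)
  next
    case (del x)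
    then show ?case
      by (simp add: clw_br.del_left clw_br.del_right clw_br.flip_act map_poly_pCons
          map_poly_1 smult_consts)
  qed (simp_all add: clw_br.add_left clw_br.add_right clw_br.flip_add clw_br.const_left
        clw_br.const_right clw_br.flip_act map_poly_pCons)
  then show ?thesis unfolding conf_skew_def by blast
qed

lemma clw_br_jacobi: "leibniz_at clw_scale (clw_br a b) (clw_br a b) x y z"
proof -
  note cb = clw_br.conf_bilinear_axioms
  have g: "leibniz_at clw_scale (clw_br a b) (clw_br a b)
      (Poly_Mapping.single g 1) (Poly_Mapping.single h 1) (Poly_Mapping.single k 1)" for g h k
  proof -
    have at: "br_at clw_scale (clw_br a b) V x y =
        poly_act (poly_act clw_scale) (poly (map_poly (\<lambda>p. [:[:p:]:]) P) V) [:[:z:]:]"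
      if "clw_br a b x y = poly_act clw_scale P [:z:]" for V x y z P
      by (simp add: br_at_def that clw_br.subst2_act) (simp add: poly_subst_def)
    have at0: "br_at clw_scale (clw_br a b) V x y = 0" if "clw_br a b x y = 0" for V x y
      by (simp add: br_at_def that poly_subst_def)
    have z: "br_at_right clw_scale (clw_br a b) V x W 0 = 0"
      "br_at_left clw_scale (clw_br a b) V W 0 x = 0" for V W x
      by (simp_all add: br_at_right_def br_at_left_def poly_subst_def
          additive.zero[OF clw_br.additive_br_at(1)] additive.zero[OF clw_br.additive_br_at(2)])
    note br = clw_br_generators[folded clw1.scale_minus_left, unfolded clw_L_def clw_G_def]
    show ?thesis
      by (cases g; cases h; cases k)
        (simp_all add: leibniz_at_def br z clw_br.br_at_right_act clw_br.br_at_left_act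
          clw_br.br_at_right_const clw_br.br_at_left_const at[OF br(1)] at[OF br(2)] at[OF br(3)] at0[OF br(4)]
          map_poly_pCons lam_def mu_def algebra_simps flip: clw2.scale_left_distrib)
  qed
  have g2: "leibniz_at clw_scale (clw_br a b) (clw_br a b)
      (Poly_Mapping.single g 1) (Poly_Mapping.single h 1) z" for g h
    by (induction z rule: clw_induct)
      (auto intro: g leibniz_at_add3 leibniz_at_const3 leibniz_at_del3 cb)
  have g1: "leibniz_at clw_scale (clw_br a b) (clw_br a b) (Poly_Mapping.single g 1) y z" for g y
    by (induction y rule: clw_induct)
      (auto intro: g2 leibniz_at_add2 leibniz_at_const2 leibniz_at_del2 cb)
  show ?thesis
    by (induction x rule: clw_induct)
      (auto intro: g1 leibniz_at_add1 leibniz_at_const1 leibniz_at_del1 cb)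
qed

lemma clw_lie_conformal_algebra: "lie_conformal_algebra clw_scale (clw_br a b)"
  using clw_br_conformal_bilinear[of a b] clw_br_skew[of a b] clw_br_jacobi[of a b]
  unfolding lie_conformal_algebra_def lie_conformal_algebra_axioms_def
    conformal_bilinear_def leibniz_at_def
  using module_clw_scale by blast

end

theory Submission
  imports Defs
begin

text \<open>
  Bracketing with \<open>L\<^sub>0\<close> and setting \<open>\<mu> = 0\<close> is the derivation \<open>\<partial>\<close>: \<open>[{L\<^sub>0}\<^sub>\<mu> w]\<close> at \<open>\<mu> = 0\<close> is \<open>\<partial>w\<close>
  for every \<open>w\<close>. Hence the biderivation identity for \<open>(x, L\<^sub>0, z)\<close> at \<open>\<mu> = 0\<close> collapses, because
  \<open>\<phi>\<^sub>\<lambda>(x, \<partial>z) = (\<partial> + \<lambda>) \<phi>\<^sub>\<lambda>(x, z)\<close>, to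
  \<open>\<lambda> \<phi>\<^sub>\<lambda>(x, z) = [\<phi>\<^sub>\<lambda>(x, L\<^sub>0)\<^sub>\<lambda> z]\<close> (\<open>biderivation_mu_0\<close>). So \<open>\<phi>\<close> is determined by the values
  \<open>\<phi>(x, L\<^sub>0)\<close>.

  Read in coordinates, with elements of \<open>R[\<lambda>]\<close> seen as families of polynomial functions of
  \<open>(\<partial>, \<lambda>) = (d, l)\<close>, this equation expresses the coordinates \<open>H\<close> of \<open>\<phi>(L\<^sub>i, L\<^sub>j)\<close> by the functions
  \<open>H(-l, l)\<close> of one variable. Skew-symmetry, which exchanges \<open>l\<close> and \<open>-d - l\<close>, then forces
  \<open>H(-l, l) / l\<close> to be constant, and zero on the \<open>G\<close>-coordinates unless \<open>b = -1\<close>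
  (\<open>skew_solutions\<close>). The values \<open>\<phi>(L\<^sub>i, G\<^sub>j)\<close> and \<open>\<phi>(G\<^sub>i, G\<^sub>j)\<close> follow from the same equation.

  Conversely, the maps in the classification are \<open>\<phi>(x, y) = T [x\<^sub>\<lambda> y]\<close>, where \<open>T\<close> is the
  \<open>\<complex>[\<partial>]\<close>-linear map taking \<open>L\<^sub>i\<close> to \<open>\<Sum>\<^sub>k a\<^sub>k L\<^bsub>i+k\<^esub>\<close>, plus \<open>\<Sum>\<^sub>k b\<^sub>k G\<^bsub>i+k\<^esub>\<close> if \<open>b = -1\<close>, and \<open>G\<^sub>i\<close> to
  \<open>\<Sum>\<^sub>k a\<^sub>k G\<^bsub>i+k\<^esub>\<close>. This \<open>T\<close> lies in the centroid, that is, it commutes with the bracket in each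
  argument (\<open>centroid_commutes\<close>); for such \<open>T\<close> the biderivation identity is \<open>T\<close> applied to the
  Jacobi identity (\<open>centroid_leibniz\<close>).
\<close>

section \<open>Module homomorphisms and polynomials over a module\<close>

lemma module_hom_map_poly:
  assumes "module_hom s s T"
  shows "module_hom (poly_act s) (poly_act s) (map_poly T)"
proof -
  interpret T: module_hom s s T by fact
  interpret P: module "poly_act s" by (rule module_poly_act) (rule T.m1.module_axioms)
  show ?thesis
    by unfold_locales
      (rule poly_eqI, simp add: coeff_map_poly T.add T.scale T.sum
        coeff_poly_act[OF T.m1.module_axioms])+
qed

lemma hom_poly_subst:
  assumes "module_hom t t U"
  shows "U (poly_subst t f V p) = poly_subst t (\<lambda>c. U (f c)) V p"
proof -
  interpret U: module_hom t t U by fact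
  show ?thesis by (simp add: poly_subst_def U.sum U.scale)
qed

lemma poly_subst_map_poly:
  assumes "module t" "f 0 = 0" "T 0 = 0"
  shows "poly_subst t f V (map_poly T p) = poly_subst t (\<lambda>c. f (T c)) V p"
  by (induction p)
    (simp_all add: map_poly_pCons assms poly_subst_pCons[OF assms(1)] poly_subst_0[OF assms(1)])

lemma poly_act_var:
  assumes "module s"
  shows "poly_act s [:0, 1:] p = pCons 0 p"
proof -
  interpret module s by fact
  interpret P: module "poly_act s" by (rule module_poly_act) fact
  have "map_poly (s 1) p = p" "map_poly (s 0) p = 0"
    by (simp_all add: map_poly_idI poly_eq_iff coeff_map_poly)
  then show ?thesis
    by (simp add: poly_act_pCons_left[OF assms])
qed

lemma poly_subst_var:
  assumes "module s" "f 0 = 0"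
  shows "poly_subst (poly_act s) (\<lambda>c. [:f c:]) [:0, 1:] p = map_poly f p"
  by (induction p) (simp_all add: poly_subst_pCons poly_subst_0 module_poly_act assms
      map_poly_pCons poly_act_var)

lemma poly_subst_at_0:
  assumes "module t" "f 0 = 0"
  shows "poly_subst t f 0 p = f (coeff p 0)"
  by (cases p) (simp_all add: poly_subst_pCons assms module.scale_zero_left)

lemma coeff_0_poly_subst:
  assumes "module t"
  shows "coeff (poly_subst (poly_act t) f V p) 0 = poly_subst t (\<lambda>c. coeff (f c) 0) (coeff V 0) p"
  by (simp add: poly_subst_def coeff_sum coeff_poly_act[OF assms] coeff_0_power)


section \<open>Setting \<open>\<mu> = 0\<close> in the biderivation identity\<close>

text \<open>
  If \<open>e\<close> acts as \<open>\<partial>\<close> at \<open>\<mu> = 0\<close>, the last term of the identity becomes \<open>\<partial> \<phi>\<^sub>\<lambda>(x, z)\<close> and cancels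
  against part of \<open>\<phi>\<^sub>\<lambda>(x, \<partial>z) = (\<partial> + \<lambda>) \<phi>\<^sub>\<lambda>(x, z)\<close>. As \<open>\<mu>\<close> is the outermost variable, setting it to
  \<open>0\<close> is taking the coefficient of index \<open>0\<close>.
\<close>

lemma biderivation_mu_0:
  assumes "conf_bilinear s br" "conf_bilinear s \<phi>" and leib: "leibniz_at s br \<phi> x e z"
    and e: "\<And>w. coeff (br e w) 0 = s [:0, 1:] w"
  shows "poly_act s [:0, 1:] (\<phi> x z) = poly_subst (poly_act s) (\<lambda>c. br c z) [:0, 1:] (\<phi> x e)"
proof -
  interpret B: conf_bilinear s br by fact
  interpret F: conf_bilinear s \<phi> by fact
  note mods = B.module_axioms B.A1.module_axioms
  have id: "poly_subst (poly_act s) (\<lambda>c. [:c:]) [:0, 1:] p = p" for p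
    using poly_subst_var[OF mods(1), of id p] by simp
  have phi: "coeff (br_at s \<phi> lam x y) 0 = \<phi> x y" for y
    by (simp add: br_at_def coeff_0_poly_subst[OF mods(2)] lam_def id)
  have left: "coeff (br_at s br (lam + mu) c z) 0 = br c z" for c
    by (simp add: br_at_def coeff_0_poly_subst[OF mods(2)] lam_def mu_def id)
  have right: "coeff (br_at s br mu e c) 0 = [:s [:0, 1:] c:]" for c
    by (simp add: br_at_def coeff_0_poly_subst[OF mods(2)] mu_def poly_subst_at_0[OF mods(2)] e)
  have "coeff (br_at_right s \<phi> lam x mu (br e z)) 0 = \<phi> x (s [:0, 1:] z)"
    by (simp add: br_at_right_def coeff_0_poly_subst[OF mods(2)] mu_def phi e
        poly_subst_at_0[OF mods(2)] F.additive_br_at additive.zero[OF F.additive_br_at(1)]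
        additive.zero[of "\<phi> x"] additive_def F.add_right)
  moreover have "coeff (br_at_left s br (lam + mu) lam (\<phi> x e) z) 0 =
      poly_subst (poly_act s) (\<lambda>c. br c z) [:0, 1:] (\<phi> x e)"
    by (simp add: br_at_left_def coeff_0_poly_subst[OF mods(2)] left) (simp add: lam_def)
  moreover have "coeff (br_at_right s br mu e lam (\<phi> x z)) 0 = map_poly (s [:0, 1:]) (\<phi> x z)"
    by (simp add: br_at_right_def coeff_0_poly_subst[OF mods(2)] right)
      (simp add: lam_def poly_subst_var[OF mods(1)])
  ultimately have "\<phi> x (s [:0, 1:] z) = poly_subst (poly_act s) (\<lambda>c. br c z) [:0, 1:] (\<phi> x e)
      + map_poly (s [:0, 1:]) (\<phi> x z)"
    using arg_cong[OF leib[unfolded leibniz_at_def], of "\<lambda>p. coeff p 0"] by simp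
  moreover have "\<phi> x (s [:0, 1:] z) = map_poly (s [:0, 1:]) (\<phi> x z) + poly_act s [:0, 1:] (\<phi> x z)"
    unfolding F.del_right poly_act_pCons_left[OF mods(1), of "[:0, 1:]"] poly_act_var[OF mods(1)]
    by (simp add: pCons_one)
  ultimately show ?thesis by simp
qed


section \<open>Centroid elements give biderivations\<close>

text \<open>
  Commuting in the first argument gives commuting in the second by skew-symmetry. All
  substitutions in the three terms commute with \<open>T\<close> acting on coefficients, so \<open>T\<close> can be pulled
  out of each term, and what is left is the Jacobi identity.
\<close>

lemma centroid_leibniz:
  assumes "conf_bilinear s br" "conf_skew s br" and T: "module_hom s s T"
    and comm: "\<And>x y. br (T x) y = map_poly T (br x y)"
    and jacobi: "leibniz_at s br br x y z"
  shows "leibniz_at s br (\<lambda>x y. map_poly T (br x y)) x y z"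
proof -
  interpret B: conf_bilinear s br by fact
  interpret T: module_hom s s T by fact
  note T1 = module_hom_map_poly[OF T]
  note T2 = module_hom_map_poly[OF T1]
  interpret T1: module_hom "poly_act s" "poly_act s" "map_poly T" by (rule T1)
  interpret T2: module_hom "poly_act (poly_act s)" "poly_act (poly_act s)" "map_poly (map_poly T)"
    by (rule T2)
  have comm': "br x (T y) = map_poly T (br x y)" for x y
  proof -
    have skew: "br u v = - conf_flip s (br v u)" for u v
      using assms(2) unfolding conf_skew_def by blast
    have "conf_flip s (map_poly T p) = map_poly T (conf_flip s p)" for p
      by (simp add: conf_flip_def hom_poly_subst[OF T1]
          poly_subst_map_poly[OF B.A1.module_axioms] T.zero map_poly_pCons)
    then have "- conf_flip s (br (T y) x) = map_poly T (- conf_flip s (br y x))"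
      by (simp add: comm T1.neg)
    then show ?thesis by (simp only: skew[of x])
  qed
  let ?T = "map_poly (map_poly T)" and ?\<phi> = "\<lambda>x y. map_poly T (br x y)"
  have at: "br_at s ?\<phi> V u v = ?T (br_at s br V u v)"
    "br_at s br V (T u) v = ?T (br_at s br V u v)"
    "br_at s br V u (T v) = ?T (br_at s br V u v)" for V u v
    by (simp_all add: br_at_def comm comm' hom_poly_subst[OF T2] T.zero
        poly_subst_map_poly[OF B.A2.module_axioms] map_poly_pCons)
  note zero = additive.zero[OF B.additive_br_at(1)] additive.zero[OF B.additive_br_at(2)]
  have "br_at_right s ?\<phi> V x W q = ?T (br_at_right s br V x W q)" for V W q
    by (simp add: br_at_right_def hom_poly_subst[OF T2] at)
  moreover have "br_at_left s br V W (map_poly T q) z = ?T (br_at_left s br V W q z)" for V W q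
    by (simp add: br_at_left_def hom_poly_subst[OF T2] at zero T.zero
        poly_subst_map_poly[OF B.A2.module_axioms])
  moreover have "br_at_right s br V y W (map_poly T q) = ?T (br_at_right s br V y W q)" for V W q
    by (simp add: br_at_right_def hom_poly_subst[OF T2] at zero T.zero
        poly_subst_map_poly[OF B.A2.module_axioms])
  ultimately show ?thesis
    using jacobi by (simp add: leibniz_at_def T2.add)
qed

lemma conf_bilinear_hom_comp:
  assumes "conf_bilinear s br" "module_hom s s T"
  shows "conf_bilinear s (\<lambda>x y. map_poly T (br x y))"
    and "conf_bilinear s (\<lambda>x y. br (T x) y)"
proof -
  interpret B: conf_bilinear s br by fact
  interpret T: module_hom s s T by fact
  interpret T1: module_hom "poly_act s" "poly_act s" "map_poly T"
    by (rule module_hom_map_poly) fact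
  show "conf_bilinear s (\<lambda>x y. map_poly T (br x y))"
    unfolding conf_bilinear_def conf_bilinear_axioms_def conformal_bilinear_def
    by (intro conjI allI C_bilinearI B.module_axioms)
      (simp_all add: B.add_left B.add_right B.const_left B.const_right B.del_left B.del_right
        T1.add T1.scale)
  show "conf_bilinear s (\<lambda>x y. br (T x) y)"
    unfolding conf_bilinear_def conf_bilinear_axioms_def conformal_bilinear_def
    by (intro conjI allI C_bilinearI B.module_axioms)
      (simp_all add: B.add_left B.add_right B.const_left B.const_right B.del_left B.del_right
        T.add T.scale)
qed


section \<open>Coordinate functions on \<open>R[\<lambda>]\<close>\<close>

definition coord :: "clw_gen \<Rightarrow> clw poly \<Rightarrow> complex poly poly" where
  "coord g p = map_poly (\<lambda>x. Poly_Mapping.lookup x g) p"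

definition poly2 :: "complex poly poly \<Rightarrow> complex \<Rightarrow> complex \<Rightarrow> complex" where
  "poly2 P d l = poly (poly P [:l:]) d"

abbreviation val :: "clw_gen \<Rightarrow> clw poly \<Rightarrow> complex \<Rightarrow> complex \<Rightarrow> complex" where
  "val g p \<equiv> poly2 (coord g p)"

lemma coeff_coord: "coeff (coord g p) n = Poly_Mapping.lookup (coeff p n) g"
  by (simp add: coord_def coeff_map_poly)

lemma poly2_simps [simp]:
  "poly2 0 d l = 0" "poly2 1 d l = 1"
  "poly2 (P + Q) d l = poly2 P d l + poly2 Q d l"
  "poly2 (P - Q) d l = poly2 P d l - poly2 Q d l"
  "poly2 (- P) d l = - poly2 P d l"
  "poly2 (P * Q) d l = poly2 P d l * poly2 Q d l"
  "poly2 (pCons p P) d l = poly p d + l * poly2 P d l"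
  "poly2 (smult p P) d l = poly p d * poly2 P d l"
  by (simp_all add: poly2_def)

text \<open>
  Values at \<open>l = 0\<close> may be left out, since two polynomials that agree at infinitely many points are
  equal. This replaces division by \<open>\<lambda>\<close>.
\<close>

lemma poly2_eqI:
  assumes "\<And>d l. l \<noteq> 0 \<Longrightarrow> poly2 P d l = poly2 Q d l"
  shows "P = Q"
proof (rule ccontr)
  assume "P \<noteq> Q"
  then have "finite {x. poly (P - Q) x = 0}" by (intro poly_roots_finite) simp
  moreover have "(\<lambda>l. [:l:]) ` (UNIV - {0}) \<subseteq> {x. poly (P - Q) x = 0}"
  proof clarify
    fix l :: complex assume "l \<noteq> 0"
    then have "poly (poly (P - Q) [:l:]) d = 0" for d
      using assms[of l d] by (simp add: poly2_def)
    then show "poly (P - Q) [:l:] = 0" using poly_all_0_iff_0 by blast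
  qed
  moreover have "infinite ((\<lambda>l::complex. [:l:]) ` (UNIV - {0}))"
    by (subst finite_image_iff) (auto simp: inj_on_def infinite_UNIV_char_0)
  ultimately show False using finite_subset by blast
qed

lemma coord_simps [simp]:
  "coord g 0 = 0" "coord g (p + q) = coord g p + coord g q" "coord g (- p) = - coord g p"
  "coord g (poly_act clw_scale P p) = P * coord g p"
  "coord g (pCons c p) = pCons (Poly_Mapping.lookup c g) (coord g p)"
  by (rule poly_eqI, simp add: coeff_coord lookup_add coeff_poly_act[OF module_clw_scale]
      coeff_mult lookup_sum coeff_pCons split: nat.split)+

lemma clw_poly_eqI:
  assumes "\<And>g d l. l \<noteq> 0 \<Longrightarrow> val g p d l = val g q d l"
  shows "p = q"
proof -
  have "coord g p = coord g q" for g by (rule poly2_eqI) (rule assms)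
  then show ?thesis
    by (metis coeff_coord poly_eqI poly_mapping_eqI)
qed

lemma val_flip: "val g (conf_flip clw_scale p) d l = val g p d (- d - l)"
  unfolding conf_flip_def
  by (induction p)
    (simp_all add: poly_subst_pCons poly_subst_0 clw1.module_axioms algebra_simps)

text \<open>
  The shape of the assumption is that of the \<open>\<lambda>\<close>-bracket with a fixed right argument: by
  sesquilinearity a coefficient \<open>p(\<partial>)\<close> on the left comes out as \<open>p(-\<lambda>)\<close>.
\<close>

lemma val_subst:
  assumes "f 0 = 0" "\<And>c. val h (f c) d l = poly (Poly_Mapping.lookup c g) (- l) * K"
  shows "val h (poly_subst (poly_act clw_scale) f [:0, 1:] p) d l = val g p (- l) l * K"
  by (induction p)
    (simp_all add: poly_subst_pCons poly_subst_0 clw1.module_axioms assms algebra_simps)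

lemma val_br_linear:
  assumes "\<And>k. val h (clw_br a b (Poly_Mapping.single k 1) z) d l = (if k = g then K else 0)"
  shows "val h (clw_br a b c z) d l = poly (Poly_Mapping.lookup c g) (- l) * K"
  by (induction c rule: clw_induct)
    (simp_all add: assms clw_br.add_left clw_br.const_left clw_br.del_left lookup_add
      lookup_single when_def distrib_right)

lemma val_br:
  "val (LGen n) (clw_br a b c (clw_L j)) d l =
     poly (Poly_Mapping.lookup c (LGen (n - j))) (- l) * (d + 2 * l)"
  "val (GGen n) (clw_br a b c (clw_L j)) d l =
     poly (Poly_Mapping.lookup c (GGen (n - j))) (- l) * - (b * d + (b - 1) * l)"
  "val (LGen n) (clw_br a b c (clw_G j)) d l = 0"
  "val (GGen n) (clw_br a b c (clw_G j)) d l =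
     poly (Poly_Mapping.lookup c (LGen (n - j))) (- l) * (d + (1 - b) * l)"
proof -
  have "val (LGen n) (clw_br a b c (clw_G j)) d l =
      poly (Poly_Mapping.lookup c (LGen 0)) (- l) * 0"
    by (rule val_br_linear, case_tac k)
      (auto simp: clw_G_def clw_br_gen lookup_single when_def)
  then show "val (LGen n) (clw_br a b c (clw_G j)) d l = 0" by simp
qed (rule val_br_linear, case_tac k;
    fastforce simp: clw_L_def clw_G_def clw_br_gen lookup_single when_def algebra_simps)+

section \<open>The functional equation for the structure functions\<close>

text \<open>
  Put \<open>w(l) = H(-l, l) / l\<close>, so that \<open>H(d, l) = -w(l) (b d + (b - 1) l)\<close> for \<open>l \<noteq> 0\<close>. The second
  argument of a skew pair is \<open>l' = -d - l\<close>, and in the symmetric coordinates \<open>l, l'\<close> skewness reads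
  \<open>w\<^sub>i(l) (l + b l') = -w\<^sub>j(l') (l' + b l)\<close> up to shifts of the first index. Taking \<open>i = j = 0\<close> and \<open>l = l'\<close> gives
  \<open>2 (1 + b) l w(l) = 0\<close>, so \<open>w\<close> vanishes unless \<open>b = -1\<close>; for \<open>b = -1\<close> the factor \<open>l - l'\<close> cancels
  and the two sides depend on different variables, so \<open>w\<close> is constant. The parameter \<open>b\<close> of this lemma is that
  of the algebra for the \<open>G\<close>-coordinates, and \<open>-1\<close> for the \<open>L\<close>-coordinates.
\<close>

lemma skew_solutions:
  fixes H :: "int \<Rightarrow> int \<Rightarrow> int \<Rightarrow> complex \<Rightarrow> complex \<Rightarrow> complex" and b :: complex
  assumes eq: "\<And>n i j d l. l * H n i j d l = H (n - j) i 0 (- l) l * - (b * d + (b - 1) * l)"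
    and skew: "\<And>n i j d l. H n i j d l = - H n j i d (- d - l)"
    and l: "l \<noteq> 0"
  shows "H n i j d l = (d + 2 * l) * (if b + 1 = 0 then H (n - i - j) 0 0 (- 1) 1 else 0)"
proof -
  define w where "w k i l = H k i 0 (- l) l / l" for k i l
  have H: "H n i j d l = w (n - j) i l * - (b * d + (b - 1) * l)" if "l \<noteq> 0" for n i j d l
    using eq[of l n i j d] that by (simp add: w_def field_simps)
  have sym: "w (n - j) i l * (l + b * l') = - w (n - i) j l' * (l' + b * l)"
    if "l \<noteq> 0" "l' \<noteq> 0" for n i j l l'
    using skew[of n i j "- l - l'" l] H[of l n i j "- l - l'"] H[of l' n j i "- l - l'"] that
    by (simp add: algebra_simps)
  show ?thesis
  proof (cases "b + 1 = 0")
    case True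
    then have b: "b = - 1" by (simp add: add_eq_0_iff2)
    have swap: "w (n - j) i l = w (n - i) j l'" if "l \<noteq> 0" "l' \<noteq> 0" "l \<noteq> l'" for n i j l l'
    proof -
      have "(w (n - j) i l - w (n - i) j l') * (l - l') = 0"
        using sym[OF that(1,2), of n j i] b by (simp add: algebra_simps)
      with that show ?thesis by simp
    qed
    \<comment> \<open>\<open>swap\<close> needs distinct arguments, hence the two auxiliary points.\<close>
    obtain l' :: complex where l': "l' \<notin> {0, 1, l}"
      using ex_new_if_finite[of "{0, 1, l}"] infinite_UNIV_char_0 by blast
    obtain l'' :: complex where l'': "l'' \<notin> {0, 1, l'}"
      using ex_new_if_finite[of "{0, 1, l'}"] infinite_UNIV_char_0 by blast
    have "w (n - j) i l = w (n - i) j l'"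
      using swap l l' by auto
    also have "\<dots> = w (n - i - j) 0 l''" 
      using swap[of l' l'' "n - i" 0 j] l' l'' by auto
    also have "\<dots> = w (n - i - j) 0 1"
      using swap[of l'' 1 "n - i - j" 0 0] l'' by auto
    finally show ?thesis
      using H[OF l, of n i j d] b by (simp add: w_def algebra_simps)
  next
    case False
    have s: "l * (1 + b) \<noteq> 0" if "l \<noteq> 0" for l
      using that False by (simp add: add.commute)
    have 0: "w k 0 l = 0" if "l \<noteq> 0" for k l
    proof -
      have "2 * (w k 0 l * (l * (1 + b))) = 0"
        using sym[OF that that, of k 0 0] by (simp add: algebra_simps)
      with s[OF that] show ?thesis by simp
    qed
    have "w (n - j) i l = 0"
    proof -
      have "w (n - j) i l * (l * (1 + b)) = 0"
        using sym[OF l l, of "n - j" 0 i] 0[OF l] by (simp add: algebra_simps)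
      with s[OF l] show ?thesis by simp
    qed
    then show ?thesis using H[OF l, of n i j d] False by simp
  qed
qed


section \<open>Linear and bilinear maps given on the generators\<close>

lemma clw_bilinear_eqI:
  assumes "conf_bilinear clw_scale \<beta>" "conf_bilinear clw_scale \<gamma>"
    and gen: "\<And>g h. \<beta> (Poly_Mapping.single g 1) (Poly_Mapping.single h 1) =
      \<gamma> (Poly_Mapping.single g 1) (Poly_Mapping.single h 1)"
  shows "\<beta> x y = \<gamma> x y"
proof -
  interpret B: conf_bilinear clw_scale \<beta> by fact
  interpret C: conf_bilinear clw_scale \<gamma> by fact
  have "\<beta> (Poly_Mapping.single g 1) y = \<gamma> (Poly_Mapping.single g 1) y" for g
    by (induction y rule: clw_induct)
      (simp_all add: gen B.add_right C.add_right B.const_right C.const_right B.del_right C.del_right)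
  then show ?thesis
    by (induction x rule: clw_induct)
      (simp_all add: B.add_left C.add_left B.const_left C.const_left B.del_left C.del_left)
qed

definition clw_extend :: "(clw_gen \<Rightarrow> clw) \<Rightarrow> clw \<Rightarrow> clw" where
  "clw_extend \<tau> x = (\<Sum>g\<in>Poly_Mapping.keys x. clw_scale (Poly_Mapping.lookup x g) (\<tau> g))"

lemma clw_extend_superset:
  assumes "finite A" "Poly_Mapping.keys x \<subseteq> A"
  shows "clw_extend \<tau> x = (\<Sum>g\<in>A. clw_scale (Poly_Mapping.lookup x g) (\<tau> g))"
  unfolding clw_extend_def
  by (rule sum.mono_neutral_left) (use assms in \<open>auto simp: in_keys_iff\<close>)

lemma module_hom_clw_extend: "module_hom clw_scale clw_scale (clw_extend \<tau>)"
proof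
  show "clw_extend \<tau> (x + y) = clw_extend \<tau> x + clw_extend \<tau> y" for x y
    using keys_add[of x y]
    by (subst (1 2 3) clw_extend_superset[of "Poly_Mapping.keys x \<union> Poly_Mapping.keys y"])
      (auto simp: lookup_add clw.scale_left_distrib sum.distrib)
  show "clw_extend \<tau> (clw_scale p x) = clw_scale p (clw_extend \<tau> x)" for p x
    using keys_clw_scale[of p x]
    by (subst (1 2) clw_extend_superset[of "Poly_Mapping.keys x"])
      (auto simp: clw.scale_sum_right)
qed

lemma clw_extend_gen: "clw_extend \<tau> (Poly_Mapping.single g 1) = \<tau> g"
  by (simp add: clw_extend_def)

definition loop_sum :: "(int \<Rightarrow> clw_gen) \<Rightarrow> (int \<Rightarrow> complex) \<Rightarrow> int \<Rightarrow> clw" where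
  "loop_sum e \<alpha> m = Sum_any (\<lambda>k. clw_scale [:\<alpha> (k - m):] (Poly_Mapping.single (e k) 1))"

lemma lookup_loop_sum:
  assumes "finite {k. \<alpha> k \<noteq> 0}"
  shows "Poly_Mapping.lookup (loop_sum LGen \<alpha> m) (LGen n) = [:\<alpha> (n - m):]"
    "Poly_Mapping.lookup (loop_sum LGen \<alpha> m) (GGen n) = 0"
    "Poly_Mapping.lookup (loop_sum GGen \<alpha> m) (GGen n) = [:\<alpha> (n - m):]"
    "Poly_Mapping.lookup (loop_sum GGen \<alpha> m) (LGen n) = 0"
proof -
  define A where "A = insert n ((\<lambda>k. k + m) ` {k. \<alpha> k \<noteq> 0})"
  have A: "finite A" "n \<in> A" using assms by (auto simp: A_def)
  have s: "loop_sum e \<alpha> m =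
      (\<Sum>k\<in>A. clw_scale [:\<alpha> (k - m):] (Poly_Mapping.single (e k) 1))" for e
    unfolding loop_sum_def
  proof (rule Sum_any.expand_superset[OF A(1)], clarify)
    fix k assume "clw_scale [:\<alpha> (k - m):] (Poly_Mapping.single (e k) 1) \<noteq> 0"
    then have "\<alpha> (k - m) \<noteq> 0" by auto
    then show "k \<in> A" unfolding A_def by (intro insertI2 image_eqI[of _ _ "k - m"]) auto
  qed
  show "Poly_Mapping.lookup (loop_sum LGen \<alpha> m) (LGen n) = [:\<alpha> (n - m):]"
    "Poly_Mapping.lookup (loop_sum LGen \<alpha> m) (GGen n) = 0"
    "Poly_Mapping.lookup (loop_sum GGen \<alpha> m) (GGen n) = [:\<alpha> (n - m):]"
    "Poly_Mapping.lookup (loop_sum GGen \<alpha> m) (LGen n) = 0"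
    using A by (simp_all add: s lookup_sum lookup_single when_def if_distrib cong: if_cong)
qed

section \<open>The centroid elements of \<open>CLW(a,b)\<close>\<close>

text \<open>
  The second summand is there only for \<open>b = -1\<close>: a map \<open>L\<^sub>m \<mapsto> G\<^bsub>m+k\<^esub>\<close>, \<open>G\<^sub>m \<mapsto> 0\<close> commutes with the bracket iff
  \<open>[L\<^sub>\<lambda> L] = (\<partial> + 2\<lambda>) L\<close> and \<open>[L\<^sub>\<lambda> G] = (\<partial> + (1 - b)\<lambda>) G\<close> have the same factor, which is \<open>b = -1\<close>.
\<close>

fun centroid_gen :: "complex \<Rightarrow> (int \<Rightarrow> complex) \<Rightarrow> (int \<Rightarrow> complex) \<Rightarrow> clw_gen \<Rightarrow> clw" where
  "centroid_gen b \<alpha> \<beta> (LGen m) =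
     loop_sum LGen \<alpha> m + (if b + 1 = 0 then loop_sum GGen \<beta> m else 0)"
| "centroid_gen b \<alpha> \<beta> (GGen m) = loop_sum GGen \<alpha> m"

lemma centroid_commutes:
  fixes b :: complex
  assumes "finite {k. \<alpha> k \<noteq> 0}" "finite {k. \<beta> k \<noteq> 0}"
  defines "T \<equiv> clw_extend (centroid_gen b \<alpha> \<beta>)"
  shows "clw_br a b (T x) y = map_poly T (clw_br a b x y)"
proof -
  interpret T: module_hom clw_scale clw_scale T
    unfolding T_def by (rule module_hom_clw_extend)
  interpret T1: module_hom "poly_act clw_scale" "poly_act clw_scale" "map_poly T"
    by (rule module_hom_map_poly[OF T.module_hom_axioms])
  have TL: "T (clw_L m) = centroid_gen b \<alpha> \<beta> (LGen m)"
    and TG: "T (clw_G m) = centroid_gen b \<alpha> \<beta> (GGen m)" for m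
    by (simp_all add: T_def clw_L_def clw_G_def clw_extend_gen del: centroid_gen.simps)
  note loop = lookup_loop_sum[OF assms(1)] lookup_loop_sum[OF assms(2)]
  have "clw_br a b (T (Poly_Mapping.single g 1)) (Poly_Mapping.single h 1) =
      map_poly T (clw_br a b (Poly_Mapping.single g 1) (Poly_Mapping.single h 1))" for g h
  proof (rule clw_poly_eqI)
    fix k d l
    have b: "b = - 1 \<or> b + 1 \<noteq> 0 \<and> 1 + b \<noteq> 0"
      by (simp add: eq_neg_iff_add_eq_0 add.commute)
    show "val k (clw_br a b (T (Poly_Mapping.single g 1)) (Poly_Mapping.single h 1)) d l =
        val k (map_poly T (clw_br a b (Poly_Mapping.single g 1) (Poly_Mapping.single h 1))) d l"
      using b by (cases g; cases h; cases k)
        (auto simp: clw_br_generators val_br TL TG loop T1.scale T1.neg T1.zero map_poly_pCons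
          T.zero lookup_add algebra_simps simp flip: clw_L_def clw_G_def)
  qed
  then show ?thesis
    using clw_bilinear_eqI[OF conf_bilinear_hom_comp(2,1)[OF clw_br.conf_bilinear_axioms
          T.module_hom_axioms]] by blast
qed

theorem theorem3p3:
  fixes a b :: complex and \<phi> :: "clw \<Rightarrow> clw \<Rightarrow> clw poly"
  assumes "conformal_bilinear clw_scale \<phi>"
    and "conf_skew clw_scale \<phi>"
  shows "conformal_biderivation clw_scale (clw_br a b) \<phi> \<longleftrightarrow>
    (\<exists>\<alpha> \<beta> :: int \<Rightarrow> complex. finite {k. \<alpha> k \<noteq> 0} \<and> finite {k. \<beta> k \<noteq> 0} \<and>
      (\<forall>i j.
        \<phi> (clw_L i) (clw_L j) = poly_act clw_scale [:[:0, 1:], [:2:]:]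
          [: Sum_any (\<lambda>k. clw_scale [:\<alpha> (k - i - j):] (clw_L k)) +
             (if b + 1 = 0 then Sum_any (\<lambda>k. clw_scale [:\<beta> (k - i - j):] (clw_G k)) else 0) :] \<and>
        \<phi> (clw_G i) (clw_G j) = 0 \<and>
        \<phi> (clw_L i) (clw_G j) = poly_act clw_scale [:[:0, 1:], [:1 - b:]:]
          [: Sum_any (\<lambda>k. clw_scale [:\<alpha> (k - i - j):] (clw_G k)) :]))"
proof -
  interpret F: conf_bilinear clw_scale \<phi>
    by unfold_locales (rule assms(1))
  have skew: "\<phi> x y = - conf_flip clw_scale (\<phi> y x)" for x y
    using assms(2) unfolding conf_skew_def by blast
  have sums: "Sum_any (\<lambda>k. clw_scale [:\<alpha> (k - i - j):] (clw_L k)) = loop_sum LGen \<alpha> (i + j)"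
    "Sum_any (\<lambda>k. clw_scale [:\<alpha> (k - i - j):] (clw_G k)) = loop_sum GGen \<alpha> (i + j)" for \<alpha> i j
    by (simp_all add: loop_sum_def clw_L_def clw_G_def diff_diff_eq)
  show ?thesis
    unfolding sums
  proof
    assume "conformal_biderivation clw_scale (clw_br a b) \<phi>"
    then have leib: "leibniz_at clw_scale (clw_br a b) \<phi> x y z" for x y z
      unfolding conformal_biderivation_def leibniz_at_def by blast
    have L0: "coeff (clw_br a b (clw_L 0) w) 0 = clw_scale [:0, 1:] w" for w
    proof (induction w rule: clw_induct)
      case (gen g)
      show ?case
        by (cases g) (simp_all add: coeff_poly_act[OF module_clw_scale] clw_br_gen clw_L_def
            clw_G_def)
    qed (simp_all add: clw_br.add_right clw_br.const_right clw_br.del_right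
        clw.scale_right_distrib coeff_poly_act[OF module_clw_scale] mult.commute)
    \<comment> \<open>\<open>\<phi>\<close> is recovered from its values at \<open>(x, L\<^sub>0)\<close>; the four equations below are its coordinates.\<close>
    have master: "poly_act clw_scale [:0, 1:] (\<phi> x z) =
        poly_subst (poly_act clw_scale) (\<lambda>c. clw_br a b c z) [:0, 1:] (\<phi> x (clw_L 0))" for x z
      by (rule biderivation_mu_0[OF clw_br.conf_bilinear_axioms F.conf_bilinear_axioms leib L0])
    have br0: "clw_br a b 0 z = 0" for z
      using clw_br.add_left[of a b 0 0 z] by simp
    have LL_L: "l * val (LGen n) (\<phi> x (clw_L j)) d l =
        val (LGen (n - j)) (\<phi> x (clw_L 0)) (- l) l * (d + 2 * l)"
      and LL_G: "l * val (GGen n) (\<phi> x (clw_L j)) d l =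
        val (GGen (n - j)) (\<phi> x (clw_L 0)) (- l) l * - (b * d + (b - 1) * l)"
      and LG_L: "l * val (LGen n) (\<phi> x (clw_G j)) d l = 0"
      and LG_G: "l * val (GGen n) (\<phi> x (clw_G j)) d l =
        val (LGen (n - j)) (\<phi> x (clw_L 0)) (- l) l * (d + (1 - b) * l)" for x n j d l
    proof -
      have *: "l * val h (\<phi> x z) d l = val g (\<phi> x (clw_L 0)) (- l) l * K"
        if "\<And>c. val h (clw_br a b c z) d l = poly (Poly_Mapping.lookup c g) (- l) * K" for z h g K
        using arg_cong[OF master, of "\<lambda>p. val h p d l"] val_subst[OF br0 that] by simp
      show "l * val (LGen n) (\<phi> x (clw_L j)) d l =
          val (LGen (n - j)) (\<phi> x (clw_L 0)) (- l) l * (d + 2 * l)"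
        "l * val (GGen n) (\<phi> x (clw_L j)) d l =
          val (GGen (n - j)) (\<phi> x (clw_L 0)) (- l) l * - (b * d + (b - 1) * l)"
        "l * val (GGen n) (\<phi> x (clw_G j)) d l =
          val (LGen (n - j)) (\<phi> x (clw_L 0)) (- l) l * (d + (1 - b) * l)"
        by (rule *, rule val_br)+
      show "l * val (LGen n) (\<phi> x (clw_G j)) d l = 0"
        using *[of "LGen n" "clw_G j" "LGen n" 0] by (simp add: val_br)
    qed
    have flip: "val g (\<phi> x y) d l = - val g (\<phi> y x) d (- d - l)" for g x y d l
      by (subst skew) (simp add: val_flip)
    define p where "p = \<phi> (clw_L 0) (clw_L 0)"
    \<comment> \<open>The point \<open>(d, l) = (-1, 1)\<close> has \<open>d + 2 l = 1\<close>, so the values there are the coefficients.\<close>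
    define \<alpha> where "\<alpha> k = val (LGen k) p (- 1) 1" for k
    define \<beta> where "\<beta> k = val (GGen k) p (- 1) 1" for k
    have "finite {k. val (e k) p d l \<noteq> 0}" if "inj e" for e :: "int \<Rightarrow> clw_gen" and d l
    proof -
      have "{k. val (e k) p d l \<noteq> 0} \<subseteq> e -` (\<Union>n\<le>degree p. Poly_Mapping.keys (coeff p n))"
      proof (rule subsetI, rule ccontr)
        fix k assume k: "k \<in> {k. val (e k) p d l \<noteq> 0}"
          "k \<notin> e -` (\<Union>n\<le>degree p. Poly_Mapping.keys (coeff p n))"
        have "Poly_Mapping.lookup (coeff p n) (e k) = 0" for n
          using k(2) by (cases "n \<le> degree p") (auto simp: in_keys_iff coeff_eq_0)
        then have "coord (e k) p = 0" by (simp add: poly_eq_iff coeff_coord)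
        with k(1) show False by simp
      qed
      moreover have "finite (e -` (\<Union>n\<le>degree p. Poly_Mapping.keys (coeff p n)))"
        using that by (intro finite_vimageI) auto
      ultimately show ?thesis by (rule finite_subset)
    qed
    then have fin: "finite {k. \<alpha> k \<noteq> 0}" "finite {k. \<beta> k \<noteq> 0}"
      by (auto simp: \<alpha>_def \<beta>_def inj_def)
    note loop = lookup_loop_sum[OF fin(1)] lookup_loop_sum[OF fin(2)]
    have L: "val (LGen n) (\<phi> (clw_L i) (clw_L j)) d l = (d + 2 * l) * \<alpha> (n - i - j)"
      if "l \<noteq> 0" for n i j d l
      using skew_solutions[of "\<lambda>n i j. val (LGen n) (\<phi> (clw_L i) (clw_L j))" "- 1", OF _ flip that] 
        LL_L by (simp add: \<alpha>_def p_def)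
    have G: "val (GGen n) (\<phi> (clw_L i) (clw_L j)) d l =
        (d + 2 * l) * (if b + 1 = 0 then \<beta> (n - i - j) else 0)"
      if "l \<noteq> 0" for n i j d l
      unfolding \<beta>_def p_def
      by (rule skew_solutions[of "\<lambda>n i j. val (GGen n) (\<phi> (clw_L i) (clw_L j))" b,
            OF LL_G flip that])
    have "\<phi> (clw_L i) (clw_L j) = poly_act clw_scale [:[:0, 1:], [:2:]:]
        [:loop_sum LGen \<alpha> (i + j) + (if b + 1 = 0 then loop_sum GGen \<beta> (i + j) else 0):]" for i j
    proof (rule clw_poly_eqI)
      fix g d l assume "(l :: complex) \<noteq> 0"
      then show "val g (\<phi> (clw_L i) (clw_L j)) d l = val g (poly_act clw_scale [:[:0, 1:], [:2:]:]
        [:loop_sum LGen \<alpha> (i + j) + (if b + 1 = 0 then loop_sum GGen \<beta> (i + j) else 0):]) d l"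
        by (cases g) (auto simp: L G loop lookup_add diff_diff_eq algebra_simps)
    qed
    moreover have "\<phi> (clw_G i) (clw_G j) = 0" for i j
    proof (rule clw_poly_eqI)
      fix g d l assume l: "(l :: complex) \<noteq> 0"
      \<comment> \<open>Flipping \<open>\<phi>(G\<^sub>i, L\<^sub>0)\<close> at \<open>(-l, l)\<close> leads to \<open>\<lambda> = 0\<close>, where \<open>LG_L\<close> says nothing; hence the
        detour over the polynomial itself.\<close>
      have "coord (LGen n) (\<phi> (clw_L 0) (clw_G i)) = 0" for n
        by (rule poly2_eqI) (use LG_L[of _ n "clw_L 0" i] in auto)
      then have GL: "val (LGen n) (\<phi> (clw_G i) (clw_L 0)) (- l) l = 0" for n
        by (simp add: flip[of _ "clw_G i"])
      show "val g (\<phi> (clw_G i) (clw_G j)) d l = val g 0 d l"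
        using l LG_L[of l _ "clw_G i" j d] LG_G[of l _ "clw_G i" j d] GL by (cases g) auto
    qed
    moreover have "\<phi> (clw_L i) (clw_G j) = poly_act clw_scale [:[:0, 1:], [:1 - b:]:]
        [:loop_sum GGen \<alpha> (i + j):]" for i j
    proof (rule clw_poly_eqI)
      fix g d l assume l: "(l :: complex) \<noteq> 0"
      have "l * (val (GGen n) (\<phi> (clw_L i) (clw_G j)) d l - (d + (1 - b) * l) * \<alpha> (n - (i + j))) = 0"
        for n
        using LG_G[of l n "clw_L i" j d] L[OF l, of "n - j" i 0 "- l"]
        by (simp add: diff_diff_eq algebra_simps)
      then have "val (GGen n) (\<phi> (clw_L i) (clw_G j)) d l = (d + (1 - b) * l) * \<alpha> (n - (i + j))" for n
        using l by simp
      then show "val g (\<phi> (clw_L i) (clw_G j)) d l =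
          val g (poly_act clw_scale [:[:0, 1:], [:1 - b:]:] [:loop_sum GGen \<alpha> (i + j):]) d l"
        using l LG_L[of l _ "clw_L i" j d] by (cases g) (auto simp: loop algebra_simps)
    qed
    ultimately show "\<exists>\<alpha> \<beta>. finite {k. \<alpha> k \<noteq> 0} \<and> finite {k. \<beta> k \<noteq> 0} \<and>
      (\<forall>i j. \<phi> (clw_L i) (clw_L j) = poly_act clw_scale [:[:0, 1:], [:2:]:]
          [:loop_sum LGen \<alpha> (i + j) + (if b + 1 = 0 then loop_sum GGen \<beta> (i + j) else 0):] \<and>
        \<phi> (clw_G i) (clw_G j) = 0 \<and>
        \<phi> (clw_L i) (clw_G j) = poly_act clw_scale [:[:0, 1:], [:1 - b:]:]
          [:loop_sum GGen \<alpha> (i + j):])"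
      using fin by blast
  next
    assume "\<exists>\<alpha> \<beta>. finite {k. \<alpha> k \<noteq> 0} \<and> finite {k. \<beta> k \<noteq> 0} \<and>
      (\<forall>i j. \<phi> (clw_L i) (clw_L j) = poly_act clw_scale [:[:0, 1:], [:2:]:]
          [:loop_sum LGen \<alpha> (i + j) + (if b + 1 = 0 then loop_sum GGen \<beta> (i + j) else 0):] \<and>
        \<phi> (clw_G i) (clw_G j) = 0 \<and>
        \<phi> (clw_L i) (clw_G j) = poly_act clw_scale [:[:0, 1:], [:1 - b:]:]
          [:loop_sum GGen \<alpha> (i + j):])"
    then obtain \<alpha> \<beta> where fin: "finite {k. \<alpha> k \<noteq> 0}" "finite {k. \<beta> k \<noteq> 0}"
      and LL: "\<And>i j. \<phi> (clw_L i) (clw_L j) = poly_act clw_scale [:[:0, 1:], [:2:]:]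
          [:centroid_gen b \<alpha> \<beta> (LGen (i + j)):]"
      and GG: "\<And>i j. \<phi> (clw_G i) (clw_G j) = 0"
      and LG: "\<And>i j. \<phi> (clw_L i) (clw_G j) = poly_act clw_scale [:[:0, 1:], [:1 - b:]:]
          [:centroid_gen b \<alpha> \<beta> (GGen (i + j)):]"
      by (auto simp del: pCons_eq_iff)
    define T where "T = clw_extend (centroid_gen b \<alpha> \<beta>)"
    have T: "module_hom clw_scale clw_scale T"
      unfolding T_def by (rule module_hom_clw_extend)
    interpret T: module_hom clw_scale clw_scale T by (rule T)
    interpret T1: module_hom "poly_act clw_scale" "poly_act clw_scale" "map_poly T"
      by (rule module_hom_map_poly[OF T])
    have TL: "T (clw_L m) = centroid_gen b \<alpha> \<beta> (LGen m)"
      and TG: "T (clw_G m) = centroid_gen b \<alpha> \<beta> (GGen m)" for m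
      by (simp_all add: T_def clw_L_def clw_G_def clw_extend_gen del: centroid_gen.simps)
    have GL: "\<phi> (clw_G i) (clw_L j) =
        - poly_act clw_scale [:[:0, b:], [:b - 1:]:] [:centroid_gen b \<alpha> \<beta> (GGen (i + j)):]" for i j
      by (rule clw_poly_eqI)
        (simp add: skew[of "clw_G i"] LG val_flip algebra_simps del: centroid_gen.simps)
    have "\<phi> x y = map_poly T (clw_br a b x y)" for x y
    proof (rule clw_bilinear_eqI[OF F.conf_bilinear_axioms
          conf_bilinear_hom_comp(1)[OF clw_br.conf_bilinear_axioms T]])
      show "\<phi> (Poly_Mapping.single g 1) (Poly_Mapping.single h 1) =
          map_poly T (clw_br a b (Poly_Mapping.single g 1) (Poly_Mapping.single h 1))" for g h
        by (cases g; cases h)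
          (simp_all add: LL LG GL GG clw_br_generators T1.scale T1.neg T1.zero map_poly_pCons
            T.zero TL TG del: centroid_gen.simps flip: clw_L_def clw_G_def)
    qed
    then have phi: "\<phi> = (\<lambda>x y. map_poly T (clw_br a b x y))" by blast
    have "leibniz_at clw_scale (clw_br a b) \<phi> x y z" for x y z
      unfolding phi
      by (rule centroid_leibniz[OF clw_br.conf_bilinear_axioms clw_br_skew T _ clw_br_jacobi])
        (simp add: T_def centroid_commutes[OF fin])
    then show "conformal_biderivation clw_scale (clw_br a b) \<phi>"
      using assms unfolding conformal_biderivation_def leibniz_at_def by blast
  qed
qed

end
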